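(* Let $B$ be any ball in $\mathbb{R}^d$. If $0<q<1$, then $$\sup\{F_{\infty,q}(\Omega) : \Omega\subset\mathbb{R}^d\text{ open and convex},\ 0<|\Omega|<\infty\}=\infty,$$ $$\min\{F_{\infty,q}(\Omega) : \Omega\subset\mathbb{R}^d\text{ open and convex},\ 0<|\Omega|<\infty\}=F_{\infty,q}(B)=(d+1)^{-q}\omega_d^{(1-q)/d}.$$ If $q>1$, then $$\sup\{F_{\infty,q}(\Omega) : \Omega\subset\mathbb{R}^d\text{ open and convex},\ 0<|\Omega|<\infty\}\le\Big(\frac12\Big)^q\omega_d^{(1-q)/d},$$ $$\inf\{F_{\infty,q}(\Omega) : \Omega\subset\mathbb{R}^d\text{ open and convex},\ 0<|\Omega|<\infty\}=0.$$
   Context: $|\Omega|$ is the Lebesgue measure of $\Omega\subset\mathbb{R}^d$, $\omega_d$ is the measure of the unit ball of $\mathbb{R}^d$, $d_\Omega(x)=\inf\{|x-y| : y\in\partial\Omega\}$ is the distance function from $\partial\Omega$, $\rho(\Omega)=\|d_\Omega\|_{L^\infty(\Omega)}$ is the inradius, and for $q>0$ $$F_{\infty,q}(\Omega)=\frac{\Big(\frac{1}{|\Omega|}\int_\Omega d_\Omega(x)\,dx\Big)^q}{\rho(\Omega)\,|\Omega|^{(q-1)/d}} .$$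
   Formalization: The claims sup = ∞ (for 0<q<1) and inf = 0 (for q>1) are stated for d ≥ 2 only; for d = 1 every admissible set is an interval and F is constantly 2·4^(-q), so both fail. All other claims are stated for every d ≥ 1. *)

theory Defs
  imports "HOL-Analysis.Analysis" "HOL-Probability.Essential_Supremum"
begin

text \<open>
  Euclidean space of dimension \<open>d\<close> is an arbitrary type \<open>'a\<close> of class
  \<open>euclidean_space\<close>, with \<open>d = DIM('a)\<close>.
\<close>

definition vol :: "'a::euclidean_space set \<Rightarrow> real" where
  "vol \<Omega> = measure lebesgue \<Omega>"

definition omega :: "'a::euclidean_space itself \<Rightarrow> real" where
  "omega _ = vol (ball (0::'a) 1)"

definition bdist :: "'a::euclidean_space set \<Rightarrow> 'a \<Rightarrow> real" where
  "bdist \<Omega> x = infdist x (frontier \<Omega>)"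

definition Linf_norm :: "'a measure \<Rightarrow> ('a \<Rightarrow> real) \<Rightarrow> ereal" where
  "Linf_norm M f = esssup M (\<lambda>x. ereal \<bar>f x\<bar>)"

text \<open>
  The norm below is finite on every open set of finite measure, such a set
  being unable to contain balls of arbitrarily large radius, so the conversion
  from \<open>ereal\<close> loses nothing on the sets \<open>adm\<close>.
\<close>

definition inradius :: "'a::euclidean_space set \<Rightarrow> real" where
  "inradius \<Omega> = real_of_ereal (Linf_norm (lebesgue_on \<Omega>) (bdist \<Omega>))"

definition F_inf :: "real \<Rightarrow> 'a::euclidean_space set \<Rightarrow> real" where
  "F_inf q \<Omega> =
     (1 / vol \<Omega> * (LINT x:\<Omega>|lebesgue. bdist \<Omega> x)) powr q /
     (inradius \<Omega> * vol \<Omega> powr ((q - 1) / real DIM('a)))"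

definition adm :: "'a::euclidean_space set set" where
  "adm = {\<Omega>. open \<Omega> \<and> convex \<Omega> \<and> 0 < emeasure lebesgue \<Omega> \<and> emeasure lebesgue \<Omega> < \<infinity>}"

end

theory Submission
  imports Defs
begin

text \<open>
  Write \<open>d\<close> for the boundary distance, \<open>\<rho>\<close> for its supremum, \<open>V\<close> for the volume and \<open>n\<close> for
  the dimension. Then
  \<open>F = (M / \<rho>) powr q * E powr (1 - q)\<close>, where \<open>M\<close> is the mean of \<open>d\<close> and
  \<open>E = V powr (1/n) / \<rho>\<close>. An inscribed ball gives \<open>E \<ge> \<omega> powr (1/n)\<close>, with equality for balls,
  and \<open>E\<close> is unbounded on thin boxes, so everything follows from \<open>1/(n+1) \<le> M / \<rho> \<le> 1/2\<close>.

  The lower bound holds because \<open>d\<close> is concave, so that \<open>{d > t}\<close> contains the image of \<open>\<Omega>\<close> under the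
  homothety of ratio \<open>1 - t / d x0\<close> centred at \<open>x0\<close>; integrate over \<open>t\<close>. For the upper bound, \<open>d\<close> has
  at each \<open>x\<close> a supergradient \<open>- a x\<close> of norm 1. Monotonicity of supergradients makes
  \<open>x \<mapsto> x + h a x\<close> distance-nondecreasing, and this map lowers \<open>d\<close> by \<open>h\<close>. Hence
  \<open>|{d > h}| \<le> |{d < \<rho> - h}|\<close> up to an arbitrarily small increase of \<open>\<rho>\<close>, and integrating over \<open>h\<close>
  gives \<open>\<integral> d \<le> \<integral> (\<rho> - d)\<close>.
\<close>

section \<open>Lebesgue measure under distance-nondecreasing maps\<close>

text \<open>Countable subadditivity over any countable index set, written as an integral over a
  counting measure so that it can be compared termwise with the equality for disjoint
  families.\<close>

lemma emeasure_UN_countable_le: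
  assumes [measurable]: "\<And>i. i \<in> I \<Longrightarrow> X i \<in> sets M" and I[simp]: "countable I"
  shows "emeasure M (\<Union>i\<in>I. X i) \<le> (\<integral>\<^sup>+i. emeasure M (X i) \<partial>count_space I)"
proof -
  have "indicator (\<Union>i\<in>I. X i) x \<le> (\<integral>\<^sup>+i. indicator (X i) x \<partial>count_space I)" for x
  proof (cases "x \<in> (\<Union>i\<in>I. X i)")
    case True
    then obtain j where j: "x \<in> X j" "j \<in> I" by auto
    have "1 = (\<integral>\<^sup>+i. indicator {j} i \<partial>count_space I)"
      using j by simp
    also have "\<dots> \<le> (\<integral>\<^sup>+i. indicator (X i) x \<partial>count_space I)"
      using j by (intro nn_integral_mono) (auto simp: indicator_def)
    finally show ?thesis using True by simp
  qed simp
  moreover have [measurable]: "(\<Union>i\<in>I. X i) \<in> sets M" by auto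
  ultimately have "(\<integral>\<^sup>+x. indicator (\<Union>i\<in>I. X i) x \<partial>M) \<le> (\<integral>\<^sup>+x. \<integral>\<^sup>+i. indicator (X i) x \<partial>count_space I \<partial>M)"
    by (intro nn_integral_mono)
  then show ?thesis
    by (simp add: nn_integral_count_space_nn_integral cong: nn_integral_cong_simp)
qed
text \<open>\<open>f\<close> has a 1-Lipschitz inverse \<open>g\<close> on the image of
  \<open>A\<close>. By Vitali, disjoint balls inside an open set barely larger than \<open>E\<close>
  cover that image up to a null set; balls of the same radii about the \<open>g\<close>-images of
  their centres then cover \<open>A\<close> up to a null set. The image itself may be
  non-measurable, hence the comparison through coverings.\<close>

lemma emeasure_le_of_expanding:
  fixes f :: "'a::euclidean_space \<Rightarrow> 'a"
  assumes A: "A \<in> sets lebesgue" and E: "E \<in> sets lebesgue" and sub: "f ` A \<subseteq> E"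
    and exp: "\<And>x y. x \<in> A \<Longrightarrow> y \<in> A \<Longrightarrow> dist x y \<le> dist (f x) (f y)"
  shows "emeasure lebesgue A \<le> emeasure lebesgue E"
proof (rule ennreal_le_epsilon)
  fix e :: real assume "0 < e"
  obtain U where U: "open U" "E \<subseteq> U" "U - E \<in> lmeasurable" "emeasure lebesgue (U - E) < ennreal e"
    using sets_lebesgue_outer_open[OF E \<open>0 < e\<close>] by blast
  define g where "g = inv_into A f"
  have inj: "inj_on f A"
    using exp by (force intro: inj_onI)
  have g: "g (f x) = x" if "x \<in> A" for x
    using that inj by (simp add: g_def)
  have g_lip: "dist (g y) (g z) \<le> dist y z" if "y \<in> f ` A" "z \<in> f ` A" for y z
    using that exp g by auto
  \<comment> \<open>Balls are coded as pairs of centre and radius; centres lie in the image of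
    \<open>A\<close>, where \<open>g\<close> inverts \<open>f\<close>.\<close>
  define K where "K = {(c, r). c \<in> f ` A \<and> 0 < r \<and> ball c r \<subseteq> U}"
  obtain C where C: "countable C" "C \<subseteq> K"
     "pairwise (\<lambda>i j. disjnt (ball (fst i) (snd i)) (ball (fst j) (snd j))) C"
     "negligible (f ` A - (\<Union>i \<in> C. ball (fst i) (snd i)))"
  proof (rule Vitali_covering_theorem_balls[of "f ` A" K fst snd])
    fix x :: 'a and d :: real assume x: "x \<in> f ` A" and "0 < d"
    then obtain k where k: "0 < k" "ball x k \<subseteq> U"
      using U sub by (meson open_contains_ball subsetD)
    define r where "r = min k (d / 2)"
    have "(x, r) \<in> K" "x \<in> ball (fst (x, r)) (snd (x, r))" "snd (x, r) < d"
      using k x \<open>0 < d\<close> by (auto simp: K_def r_def)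
    then show "\<exists>i. i \<in> K \<and> x \<in> ball (fst i) (snd i) \<and> snd i < d"
      by blast
  qed
  define N where "N = f ` A - (\<Union>i \<in> C. ball (fst i) (snd i))"
  \<comment> \<open>A 1-Lipschitz map sends null sets to null sets.\<close>
  have N: "negligible (g ` N)"
    using C(4) g_lip unfolding N_def
    by (intro negligible_locally_Lipschitz_image)
       (auto simp: dist_norm intro!: exI[of _ UNIV] exI[of _ 1])
  define D where "D = (\<Union>i \<in> C. ball (g (fst i)) (snd i))"
  have "A \<subseteq> g ` N \<union> D"
  proof
    fix x assume x: "x \<in> A"
    show "x \<in> g ` N \<union> D"
    proof (cases "f x \<in> N")
      case True
      then show ?thesis using g[OF x] by force
    next
      case False
      then obtain c r where cr: "(c, r) \<in> C" "f x \<in> ball c r"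
        using x by (auto simp: N_def)
      then have "c \<in> f ` A" using C(2) by (auto simp: K_def)
      then have "dist (g c) x \<le> dist c (f x)"
        using g_lip[of c "f x"] g[OF x] x by auto
      then have "x \<in> ball (g c) r" using cr by auto
      then show ?thesis using cr by (force simp: D_def)
    qed
  qed
  moreover have "g ` N \<in> null_sets lebesgue"
    using N by (simp add: negligible_iff_null_sets)
  moreover have "open D"
    unfolding D_def by auto
  ultimately have "emeasure lebesgue A \<le> emeasure lebesgue (g ` N \<union> D)"
    by (intro emeasure_mono) auto
  also have "\<dots> = emeasure lebesgue D"
    using \<open>g ` N \<in> null_sets lebesgue\<close> \<open>open D\<close>
    by (subst Un_commute, intro emeasure_Un_null_set) auto
  \<comment> \<open>The moved balls may overlap, so only subadditivity applies. Moving the centres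
    back changes no volume and restores disjointness, which turns the sum into the measure of a
    subset of \<open>U\<close>.\<close>
  also have "\<dots> \<le> (\<integral>\<^sup>+i. emeasure lebesgue (ball (g (fst i)) (snd i)) \<partial>count_space C)"
    unfolding D_def using C(1) by (intro emeasure_UN_countable_le) auto
  also have "\<dots> = (\<integral>\<^sup>+i. emeasure lebesgue (ball (fst i) (snd i)) \<partial>count_space C)"
    using C(2) by (intro nn_integral_cong) (auto simp: K_def emeasure_ball)
  also have "\<dots> = emeasure lebesgue (\<Union>i \<in> C. ball (fst i) (snd i))"
    using C(1,3) by (intro emeasure_UN_countable[symmetric])
      (auto simp: disjoint_family_on_def pairwise_def disjnt_def)
  also have "\<dots> \<le> emeasure lebesgue U"
    using C(2) U(1) by (intro emeasure_mono) (fastforce simp: K_def)+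
  also have "\<dots> \<le> emeasure lebesgue E + emeasure lebesgue (U - E)"
  proof -
    have "E \<union> (U - E) = U" using U by auto
    then show ?thesis
      using emeasure_subadditive[OF E fmeasurableD[OF U(3)]] by simp
  qed
  also have "\<dots> \<le> emeasure lebesgue E + ennreal e"
    using U(4) by (intro add_left_mono less_imp_le)
  finally show "emeasure lebesgue A \<le> emeasure lebesgue E + ennreal e" .
qed

section \<open>Layer cake formula and a power integral\<close>

text \<open>Fubini for the region between 0 and the graph of \<open>g\<close>; negative values of
  \<open>g\<close> count as 0 on both sides.\<close>

lemma (in sigma_finite_measure) nn_integral_layer_cake:
  fixes g :: "'a \<Rightarrow> real"
  assumes [measurable]: "g \<in> borel_measurable M"
  shows "(\<integral>\<^sup>+x. ennreal (g x) \<partial>M) =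
    (\<integral>\<^sup>+t. emeasure M {x \<in> space M. t < g x} * indicator {0<..} t \<partial>lborel)"
proof -
  interpret pair_sigma_finite M lborel ..
  have "(\<integral>\<^sup>+x. ennreal (g x) \<partial>M) = (\<integral>\<^sup>+x. \<integral>\<^sup>+t. indicator {0<..<g x} t \<partial>lborel \<partial>M)"
  proof (intro nn_integral_cong)
    fix x
    show "ennreal (g x) = (\<integral>\<^sup>+t. indicator {0<..<g x} t \<partial>lborel)"
      by (cases "0 \<le> g x") (auto simp: ennreal_neg)
  qed
  also have "\<dots> = (\<integral>\<^sup>+x. \<integral>\<^sup>+t. indicator {(x, t). 0 < t \<and> t < g x} (x, t) \<partial>lborel \<partial>M)"
    by (intro nn_integral_cong) (auto simp: indicator_def)
  also have "\<dots> = (\<integral>\<^sup>+t. \<integral>\<^sup>+x. indicator {(x, t). 0 < t \<and> t < g x} (x, t) \<partial>M \<partial>lborel)"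
    by (intro Fubini'[symmetric]) measurable
  also have "\<dots> = (\<integral>\<^sup>+t. \<integral>\<^sup>+x. indicator {x \<in> space M. t < g x} x * indicator {0<..} t \<partial>M \<partial>lborel)"
    by (intro nn_integral_cong) (auto simp: indicator_def)
  also have "\<dots> = (\<integral>\<^sup>+t. emeasure M {x \<in> space M. t < g x} * indicator {0<..} t \<partial>lborel)"
    by (simp add: nn_integral_multc)
  finally show ?thesis .
qed

text \<open>Source of the factor \<open>1 / (d + 1)\<close>: with \<open>n\<close> the dimension,
  the integrand is the volume factor of a homothety of ratio \<open>1 - t / c\<close>.\<close>

lemma nn_integral_power_ramp:
  fixes c :: real
  assumes "0 < c"
  shows "(\<integral>\<^sup>+t. ennreal ((1 - t / c) ^ n) * indicator {0<..c} t \<partial>lborel) = ennreal (c / (real n + 1))"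
proof -
  let ?f = "\<lambda>t. (1 - t / c) ^ n"
  let ?F = "\<lambda>t. - c / real (Suc n) * (1 - t / c) ^ Suc n"
  \<comment> \<open>Adding the endpoint 0 costs only a null set and gives the closed interval that
    the fundamental theorem of calculus expects.\<close>
  have "(\<integral>\<^sup>+t. ennreal (?f t) * indicator {0<..c} t \<partial>lborel) =
      (\<integral>\<^sup>+t. ennreal (?f t) * indicator {0..c} t \<partial>lborel)"
  proof (rule nn_integral_cong_AE)
    show "AE t in lborel. ennreal (?f t) * indicator {0<..c} t = ennreal (?f t) * indicator {0..c} t"
      using AE_lborel_singleton[of 0] by eventually_elim (simp add: indicator_def)
  qed
  also have "\<dots> = ennreal (?F c - ?F 0)"
  proof (rule nn_integral_FTC_Icc[where F = ?F])
    fix x assume x: "x \<in> {0..c}"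
    have "((\<lambda>t. 1 - t / c) has_real_derivative - (1 / c)) (at x)"
      using assms by (auto intro!: derivative_eq_intros)
    from DERIV_cmult[OF DERIV_power[OF this, of "Suc n"], of "- c / real (Suc n)"]
    show "(?F has_real_derivative ?f x) (at x)"
      by (rule DERIV_cong) (use assms in \<open>simp del: of_nat_Suc\<close>)
    show "0 \<le> ?f x"
      using assms x by (intro zero_le_power) simp
  qed (use assms in \<open>simp_all\<close>)
  also have "?F c - ?F 0 = c / (real n + 1)"
    using assms by (simp add: add.commute)
  finally show ?thesis .
qed

section \<open>Boundary distance on open convex sets\<close>

text \<open>Balls are connected: one that meets both \<open>\<Omega>\<close> and its complement
  meets the frontier, at a point closer to \<open>x\<close> than \<open>bdist\<close>
  allows.\<close>

lemma ball_bdist_subset: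
  assumes "x \<in> \<Omega>"
  shows "ball x (bdist \<Omega> x) \<subseteq> \<Omega>"
proof (rule ccontr)
  assume "\<not> ball x (bdist \<Omega> x) \<subseteq> \<Omega>"
  then have ne: "ball x (bdist \<Omega> x) - \<Omega> \<noteq> {}" by auto
  then have "x \<in> ball x (bdist \<Omega> x)"
    by (metis Diff_eq_empty_iff ball_eq_empty centre_in_ball empty_subsetI linorder_not_le)
  then have "ball x (bdist \<Omega> x) \<inter> frontier \<Omega> \<noteq> {}"
    using assms by (intro connected_Int_frontier[OF connected_ball _ ne]) blast
  then obtain y where "y \<in> frontier \<Omega>" "dist x y < bdist \<Omega> x" by auto
  then show False
    using infdist_le[of y "frontier \<Omega>" x] by (simp add: bdist_def)
qed

text \<open>Converse of \<open>ball_bdist_subset\<close>: frontier points of an open set lie outside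
  it, hence outside the ball. A nonempty frontier matters because \<open>infdist\<close> to the
  empty set is 0.\<close>

lemma bdist_geI:
  assumes "open \<Omega>" "frontier \<Omega> \<noteq> {}" "ball x r \<subseteq> \<Omega>"
  shows "r \<le> bdist \<Omega> x"
proof -
  have "r \<le> dist x y" if "y \<in> frontier \<Omega>" for y
    using that assms by (force simp: frontier_def interior_open not_less[symmetric])
  then show ?thesis
    using assms(2) unfolding bdist_def infdist_notempty[OF assms(2)] by (intro cINF_greatest) auto
qed

lemma bdist_pos:
  assumes "open \<Omega>" "frontier \<Omega> \<noteq> {}" "x \<in> \<Omega>"
  shows "0 < bdist \<Omega> x"
proof -
  obtain e where "0 < e" "ball x e \<subseteq> \<Omega>"
    using assms open_contains_ball by blast
  with bdist_geI[OF assms(1,2)] show ?thesis by fastforce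
qed

lemma bdist_nonneg [simp]: "0 \<le> bdist \<Omega> x"
  by (simp add: bdist_def infdist_nonneg)

lemma continuous_on_bdist: "continuous_on S (bdist \<Omega>)"
  unfolding bdist_def[abs_def] by (intro continuous_intros)

lemma bdist_borel_measurable [measurable]: "bdist \<Omega> \<in> borel_measurable borel"
  by (intro borel_measurable_continuous_onI continuous_on_bdist)

text \<open>The convex combination of the inscribed balls about \<open>x\<close> and
  \<open>y\<close> is the ball with the combined centre and radius, and convexity keeps it inside
  \<open>\<Omega>\<close>.\<close>

lemma bdist_concave:
  assumes "open \<Omega>" "convex \<Omega>" "frontier \<Omega> \<noteq> {}" "x \<in> \<Omega>" "y \<in> \<Omega>" "0 \<le> u" "u \<le> 1"
  shows "(1 - u) * bdist \<Omega> x + u * bdist \<Omega> y \<le> bdist \<Omega> ((1 - u) *\<^sub>R x + u *\<^sub>R y)"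
proof (rule bdist_geI[OF assms(1,3)])
  let ?a = "bdist \<Omega> x" and ?b = "bdist \<Omega> y"
  let ?R = "(1 - u) * ?a + u * ?b" and ?z = "(1 - u) *\<^sub>R x + u *\<^sub>R y"
  show "ball ?z ?R \<subseteq> \<Omega>"
  proof
    fix w assume "w \<in> ball ?z ?R"
    then have w: "norm (w - ?z) < ?R" by (simp add: dist_norm norm_minus_commute)
    then have R: "0 < ?R" using norm_ge_zero le_less_trans by blast
    \<comment> \<open>\<open>v\<close> is the relative position of \<open>w\<close> in its ball; the
      points at the same relative position in the two given balls combine to
      \<open>w\<close>.\<close>
    define v where "v = (1 / ?R) *\<^sub>R (w - ?z)"
    have v: "norm v < 1" using w R by (simp add: v_def)
    have pos: "0 < ?a" "0 < ?b" using bdist_pos assms by auto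
    have "x + ?a *\<^sub>R v \<in> ball x ?a" "y + ?b *\<^sub>R v \<in> ball y ?b"
      using v pos by (auto simp: dist_norm)
    then have "x + ?a *\<^sub>R v \<in> \<Omega>" "y + ?b *\<^sub>R v \<in> \<Omega>"
      using ball_bdist_subset assms by blast+
    then have "(1 - u) *\<^sub>R (x + ?a *\<^sub>R v) + u *\<^sub>R (y + ?b *\<^sub>R v) \<in> \<Omega>"
      using assms by (intro convexD) auto
    also have "(1 - u) *\<^sub>R (x + ?a *\<^sub>R v) + u *\<^sub>R (y + ?b *\<^sub>R v) = ?z + ?R *\<^sub>R v"
      by (simp add: algebra_simps)
    also have "\<dots> = w" using R by (simp add: v_def)
    finally show "w \<in> \<Omega>" .
  qed
qed

text \<open>\<open>a\<close> is the outward unit normal of a hyperplane supporting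
  \<open>\<Omega>\<close> at a frontier point \<open>y\<close> nearest to \<open>x\<close>. The
  affine function \<open>a \<bullet> (y - z)\<close> of \<open>z\<close> dominates
  \<open>bdist \<Omega>\<close> on \<open>\<Omega>\<close> and does not exceed it at
  \<open>x\<close>.\<close>

lemma bdist_supergradient:
  fixes \<Omega> :: "'a::euclidean_space set"
  assumes "open \<Omega>" "convex \<Omega>" "frontier \<Omega> \<noteq> {}" "x \<in> \<Omega>"
  obtains a where "norm a = 1" "\<And>z. z \<in> \<Omega> \<Longrightarrow> bdist \<Omega> z \<le> bdist \<Omega> x + a \<bullet> (x - z)"
proof -
  obtain y where y: "y \<in> frontier \<Omega>" "bdist \<Omega> x = dist x y"
    using infdist_attains_inf[of "frontier \<Omega>" x] assms by (auto simp: bdist_def)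
  have "y \<notin> \<Omega>" using y assms(1) by (auto simp: frontier_def interior_open)
  then obtain a' b where a': "a' \<noteq> 0" "\<And>w. w \<in> \<Omega> \<Longrightarrow> a' \<bullet> w \<le> b" "b \<le> a' \<bullet> y"
    using separating_hyperplane_sets[of \<Omega> "{y}"] assms by auto
  define a where "a = (1 / norm a') *\<^sub>R a'"
  have a: "norm a = 1" "a \<bullet> a = 1" using a' by (auto simp: a_def dot_square_norm power2_eq_square)
  have sep: "a \<bullet> w \<le> a \<bullet> y" if "w \<in> \<Omega>" for w
    using a'(1) a'(2)[OF that] a'(3) by (auto simp: a_def divide_simps)
  have "bdist \<Omega> z \<le> bdist \<Omega> x + a \<bullet> (x - z)" if z: "z \<in> \<Omega>" for z
  proof -
    \<comment> \<open>Walking from \<open>z\<close> along \<open>a\<close> by any \<open>s\<close>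
      below \<open>bdist \<Omega> z\<close> stays in \<open>\<Omega>\<close>, so it does not cross
      the hyperplane.\<close>
    have "bdist \<Omega> z \<le> a \<bullet> (y - z)"
    proof (rule dense_le_bounded)
      show "0 < bdist \<Omega> z" using bdist_pos assms z by auto
      fix s assume s: "0 < s" "s < bdist \<Omega> z"
      then have "z + s *\<^sub>R a \<in> ball z (bdist \<Omega> z)" using a by (simp add: dist_norm)
      then have "a \<bullet> (z + s *\<^sub>R a) \<le> a \<bullet> y"
        using ball_bdist_subset[OF z] sep by blast
      then show "s \<le> a \<bullet> (y - z)" using a by (simp add: algebra_simps)
    qed
    moreover have "a \<bullet> (y - x) \<le> bdist \<Omega> x"
      using norm_cauchy_schwarz[of a "y - x"] a y by (simp add: dist_norm norm_minus_commute)
    ultimately show ?thesis by (simp add: algebra_simps)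
  qed
  with a that show thesis by blast
qed

section \<open>Measure of superlevel sets of the boundary distance\<close>

text \<open>Each \<open>x\<close> is pushed by \<open>h\<close> along the normal \<open>a x\<close>.
  The strict bound \<open>\<rho>\<close> makes the target a strict superlevel set of
  \<open>\<rho> - bdist \<Omega>\<close>, the form that the layer cake formula uses.\<close>

lemma emeasure_bdist_gt_le:
  fixes \<Omega> :: "'a::euclidean_space set"
  assumes \<Omega>: "open \<Omega>" "convex \<Omega>" "frontier \<Omega> \<noteq> {}"
    and bound: "\<And>x. x \<in> \<Omega> \<Longrightarrow> bdist \<Omega> x < \<rho>" and "0 < h"
  shows "emeasure lebesgue {x \<in> \<Omega>. h < bdist \<Omega> x} \<le> emeasure lebesgue {x \<in> \<Omega>. bdist \<Omega> x < \<rho> - h}"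
proof -
  \<comment> \<open>\<open>a\<close> is chosen point by point and may fail to be measurable;
    \<open>emeasure_le_of_expanding\<close> asks of the map only the inclusion and the distance
    inequality.\<close>
  define a where "a x = (SOME a. norm a = 1 \<and> (\<forall>z\<in>\<Omega>. bdist \<Omega> z \<le> bdist \<Omega> x + a \<bullet> (x - z)))" for x
  have a: "norm (a x) = 1" "\<And>z. z \<in> \<Omega> \<Longrightarrow> bdist \<Omega> z \<le> bdist \<Omega> x + a x \<bullet> (x - z)" if "x \<in> \<Omega>" for x
  proof -
    have "\<exists>a. norm a = 1 \<and> (\<forall>z\<in>\<Omega>. bdist \<Omega> z \<le> bdist \<Omega> x + a \<bullet> (x - z))"
      using bdist_supergradient[OF \<Omega> that] by metis
    from someI_ex[OF this] show "norm (a x) = 1" "\<And>z. z \<in> \<Omega> \<Longrightarrow> bdist \<Omega> z \<le> bdist \<Omega> x + a x \<bullet> (x - z)"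
      by (auto simp: a_def)
  qed
  have meas: "{x \<in> \<Omega>. P (bdist \<Omega> x)} \<in> sets lebesgue" if [measurable]: "Measurable.pred borel P" for P
  proof -
    have [measurable]: "\<Omega> \<in> sets borel" using \<Omega> by auto
    have "{x \<in> \<Omega>. P (bdist \<Omega> x)} \<in> sets borel" by measurable
    then show ?thesis by auto
  qed
  show ?thesis
  proof (rule emeasure_le_of_expanding[where f = "\<lambda>x. x + h *\<^sub>R a x"])
    show "(\<lambda>x. x + h *\<^sub>R a x) ` {x \<in> \<Omega>. h < bdist \<Omega> x} \<subseteq> {x \<in> \<Omega>. bdist \<Omega> x < \<rho> - h}"
    proof clarify
      fix x assume x: "x \<in> \<Omega>" "h < bdist \<Omega> x"
      have "x + h *\<^sub>R a x \<in> ball x (bdist \<Omega> x)"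
        using a[OF x(1)] x \<open>0 < h\<close> by (simp add: dist_norm)
      then have T: "x + h *\<^sub>R a x \<in> \<Omega>" using ball_bdist_subset x by blast
      have "bdist \<Omega> (x + h *\<^sub>R a x) \<le> bdist \<Omega> x + a x \<bullet> (x - (x + h *\<^sub>R a x))"
        by (rule a(2)[OF x(1) T])
      also have "\<dots> = bdist \<Omega> x - h"
        using a(1)[OF x(1)] by (simp add: dot_square_norm)
      finally show "x + h *\<^sub>R a x \<in> \<Omega> \<and> bdist \<Omega> (x + h *\<^sub>R a x) < \<rho> - h"
        using T bound[OF x(1)] by auto
    qed
  next
    fix x y assume "x \<in> {x \<in> \<Omega>. h < bdist \<Omega> x}" "y \<in> {x \<in> \<Omega>. h < bdist \<Omega> x}"
    then have xy: "x \<in> \<Omega>" "y \<in> \<Omega>" by auto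
    \<comment> \<open>Add the supergradient inequalities at \<open>x\<close> and at
      \<open>y\<close>; the values of \<open>bdist\<close> cancel.\<close>
    have mono: "0 \<le> (x - y) \<bullet> (a x - a y)"
      using a(2)[OF xy] a(2)[OF xy(2,1)] by (simp add: algebra_simps inner_commute)
    have "(norm (x - y))\<^sup>2 \<le> (norm (x - y))\<^sup>2 + 2 * h * ((x - y) \<bullet> (a x - a y)) + (norm (h *\<^sub>R (a x - a y)))\<^sup>2"
      using mono \<open>0 < h\<close> by simp
    also have "\<dots> = (norm ((x - y) + h *\<^sub>R (a x - a y)))\<^sup>2"
      by (simp add: power2_norm_eq_inner algebra_simps inner_commute)
    finally have "norm (x - y) \<le> norm ((x - y) + h *\<^sub>R (a x - a y))"
      by (simp add: power2_le_iff_abs_le)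
    then show "dist x y \<le> dist (x + h *\<^sub>R a x) (y + h *\<^sub>R a y)"
      by (simp add: dist_norm algebra_simps)
  qed (auto intro!: meas)
qed

text \<open>The homothety with centre \<open>x0\<close> and ratio \<open>1 - u\<close> maps
  \<open>\<Omega>\<close> into the superlevel set by concavity: \<open>u\<close> is such that the
  \<open>x0\<close> term alone contributes \<open>t\<close>, and positivity of \<open>bdist\<close>
  at the other point makes the inequality strict.\<close>

lemma emeasure_bdist_gt_ge:
  fixes \<Omega> :: "'a::euclidean_space set"
  assumes \<Omega>: "open \<Omega>" "convex \<Omega>" "frontier \<Omega> \<noteq> {}"
    and "x0 \<in> \<Omega>" "0 \<le> t" "t < bdist \<Omega> x0"
  shows "ennreal ((1 - t / bdist \<Omega> x0) ^ DIM('a)) * emeasure lebesgue \<Omega> \<le> emeasure lebesgue {x \<in> \<Omega>. t < bdist \<Omega> x}"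
proof -
  let ?c = "bdist \<Omega> x0"
  define u where "u = t / ?c"
  have "0 < ?c" using bdist_pos assms by auto
  then have u: "0 \<le> u" "u < 1" "u * ?c = t" using assms by (auto simp: u_def)
  have [measurable]: "\<Omega> \<in> sets borel" using \<Omega> by auto
  have meas: "{x \<in> \<Omega>. t < bdist \<Omega> x} \<in> sets borel" by measurable
  have "(\<lambda>x. (1 - u) *\<^sub>R x + u *\<^sub>R x0) ` \<Omega> \<subseteq> {x \<in> \<Omega>. t < bdist \<Omega> x}"
  proof clarify
    fix x assume x: "x \<in> \<Omega>"
    have "t < (1 - u) * bdist \<Omega> x + u * ?c" using u bdist_pos[OF \<Omega>(1,3) x] by simp
    also have "\<dots> \<le> bdist \<Omega> ((1 - u) *\<^sub>R x + u *\<^sub>R x0)"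
      using assms u x by (intro bdist_concave) auto
    finally show "(1 - u) *\<^sub>R x + u *\<^sub>R x0 \<in> \<Omega> \<and> t < bdist \<Omega> ((1 - u) *\<^sub>R x + u *\<^sub>R x0)"
      using assms u x by (auto intro!: convexD)
  qed
  then have "emeasure lebesgue ((\<lambda>x. (1 - u) *\<^sub>R x + u *\<^sub>R x0) ` \<Omega>) \<le> emeasure lebesgue {x \<in> \<Omega>. t < bdist \<Omega> x}"
    using meas by (intro emeasure_mono) auto
  then show ?thesis
    using emeasure_lebesgue_affine[of "1 - u" "u *\<^sub>R x0" \<Omega>] u
    by (simp add: u_def flip: ennreal_power)
qed

section \<open>Bounds for the integral of the boundary distance\<close>

lemma nn_integral_bdist_layer_cake:
  assumes [measurable]: "\<Omega> \<in> sets borel"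
  shows "(\<integral>\<^sup>+x. ennreal (bdist \<Omega> x) * indicator \<Omega> x \<partial>lborel) =
    (\<integral>\<^sup>+t. emeasure lebesgue {x \<in> \<Omega>. t < bdist \<Omega> x} * indicator {0<..} t \<partial>lborel)"
proof -
  have "(\<integral>\<^sup>+x. ennreal (bdist \<Omega> x) * indicator \<Omega> x \<partial>lborel) =
      (\<integral>\<^sup>+x. ennreal (bdist \<Omega> x * indicator \<Omega> x) \<partial>lborel)"
    by (intro nn_integral_cong) (simp add: indicator_def)
  also have "\<dots> = (\<integral>\<^sup>+t. emeasure lborel {x \<in> space lborel. t < bdist \<Omega> x * indicator \<Omega> x} * indicator {0<..} t \<partial>lborel)"
    by (rule lborel.nn_integral_layer_cake) measurable
  also have "\<dots> = (\<integral>\<^sup>+t. emeasure lebesgue {x \<in> \<Omega>. t < bdist \<Omega> x} * indicator {0<..} t \<partial>lborel)"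
  proof (intro nn_integral_cong)
    fix t :: real
    have "{x \<in> space lborel. t < bdist \<Omega> x * indicator \<Omega> x} = {x \<in> \<Omega>. t < bdist \<Omega> x}" if "0 < t"
      using that by (auto simp: indicator_def)
    then show "emeasure lborel {x \<in> space lborel. t < bdist \<Omega> x * indicator \<Omega> x} * indicator {0<..} t =
        emeasure lebesgue {x \<in> \<Omega>. t < bdist \<Omega> x} * indicator {0<..} t"
      by (cases "0 < t") auto
  qed
  finally show ?thesis .
qed

lemma nn_integral_bdist_le:
  fixes \<Omega> :: "'a::euclidean_space set"
  assumes \<Omega>: "open \<Omega>" "convex \<Omega>" "frontier \<Omega> \<noteq> {}"
    and bound: "\<And>x. x \<in> \<Omega> \<Longrightarrow> bdist \<Omega> x < \<rho>"
  shows "2 * (\<integral>\<^sup>+x. ennreal (bdist \<Omega> x) * indicator \<Omega> x \<partial>lborel) \<le> ennreal \<rho> * emeasure lebesgue \<Omega>"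
proof -
  have [measurable]: "\<Omega> \<in> sets borel" using \<Omega> by auto
  let ?I = "\<integral>\<^sup>+x. ennreal (bdist \<Omega> x) * indicator \<Omega> x \<partial>lborel"
  let ?g = "\<lambda>x. (\<rho> - bdist \<Omega> x) * indicator \<Omega> x"
  have "?I \<le> (\<integral>\<^sup>+t. emeasure lborel {x \<in> space lborel. t < ?g x} * indicator {0<..} t \<partial>lborel)"
    unfolding nn_integral_bdist_layer_cake[OF \<open>\<Omega> \<in> sets borel\<close>]
  proof (intro nn_integral_mono)
    fix t :: real
    have "emeasure lebesgue {x \<in> \<Omega>. t < bdist \<Omega> x} \<le> emeasure lborel {x \<in> space lborel. t < ?g x}" if "0 < t"
    proof -
      have "{x \<in> space lborel. t < ?g x} = {x \<in> \<Omega>. bdist \<Omega> x < \<rho> - t}"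
        using that by (auto simp: indicator_def)
      moreover have "{x \<in> \<Omega>. bdist \<Omega> x < \<rho> - t} \<in> sets lborel" by measurable
      ultimately show ?thesis
        using emeasure_bdist_gt_le[OF \<Omega> bound that] by simp
    qed
    then show "emeasure lebesgue {x \<in> \<Omega>. t < bdist \<Omega> x} * indicator {0<..} t
        \<le> emeasure lborel {x \<in> space lborel. t < ?g x} * indicator {0<..} t"
      by (cases "0 < t") auto
  qed
  also have "\<dots> = (\<integral>\<^sup>+x. ennreal (?g x) \<partial>lborel)"
    by (rule lborel.nn_integral_layer_cake[symmetric]) measurable
  \<comment> \<open>The integral is added to both sides instead of subtracted, which is sound in
    \<open>ennreal\<close> before finiteness is known.\<close>
  finally have "2 * ?I \<le> ?I + (\<integral>\<^sup>+x. ennreal (?g x) \<partial>lborel)"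
    by (simp add: mult_2)
  also have "\<dots> = (\<integral>\<^sup>+x. ennreal (bdist \<Omega> x) * indicator \<Omega> x + ennreal (?g x) \<partial>lborel)"
    by (rule nn_integral_add[symmetric]) measurable
  also have "\<dots> = (\<integral>\<^sup>+x. ennreal \<rho> * indicator \<Omega> x \<partial>lborel)"
    using bound by (intro nn_integral_cong) (auto simp: indicator_def less_imp_le simp flip: ennreal_plus)
  also have "\<dots> = ennreal \<rho> * emeasure lebesgue \<Omega>"
    by (simp add: nn_integral_cmult)
  finally show ?thesis .
qed

lemma nn_integral_bdist_ge:
  fixes \<Omega> :: "'a::euclidean_space set"
  assumes \<Omega>: "open \<Omega>" "convex \<Omega>" "frontier \<Omega> \<noteq> {}" and x0: "x0 \<in> \<Omega>"
  shows "ennreal (bdist \<Omega> x0 / (real DIM('a) + 1)) * emeasure lebesgue \<Omega>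
    \<le> (\<integral>\<^sup>+x. ennreal (bdist \<Omega> x) * indicator \<Omega> x \<partial>lborel)"
proof -
  let ?c = "bdist \<Omega> x0"
  have [measurable]: "\<Omega> \<in> sets borel" using \<Omega> by auto
  have "ennreal (?c / (real DIM('a) + 1)) * emeasure lebesgue \<Omega>
      = (\<integral>\<^sup>+t. ennreal ((1 - t / ?c) ^ DIM('a)) * indicator {0<..?c} t * emeasure lebesgue \<Omega> \<partial>lborel)"
    using bdist_pos[OF \<Omega>(1,3) x0] nn_integral_power_ramp[of ?c "DIM('a)"] by (simp add: nn_integral_multc)
  also have "\<dots> \<le> (\<integral>\<^sup>+t. emeasure lebesgue {x \<in> \<Omega>. t < bdist \<Omega> x} * indicator {0<..} t \<partial>lborel)"
  proof (intro nn_integral_mono)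
    fix t
    \<comment> \<open>\<open>emeasure_bdist_gt_ge\<close> covers \<open>t < ?c\<close>; at
      \<open>t = ?c\<close> the ramp is 0 because the dimension is positive.\<close>
    consider "t \<notin> {0<..?c}" | "t = ?c" | "0 < t" "t < ?c" by force
    then show "ennreal ((1 - t / ?c) ^ DIM('a)) * indicator {0<..?c} t * emeasure lebesgue \<Omega>
        \<le> emeasure lebesgue {x \<in> \<Omega>. t < bdist \<Omega> x} * indicator {0<..} t"
    proof cases
      case 3
      then show ?thesis using emeasure_bdist_gt_ge[OF \<Omega> x0, of t] by simp
    qed (use bdist_pos[OF \<Omega>(1,3) x0] in \<open>auto simp: zero_power\<close>)
  qed
  finally show ?thesis by (simp add: nn_integral_bdist_layer_cake)
qed

section \<open>Admissible sets and the inradius as a supremum\<close>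

text \<open>Only the empty set and the whole space have empty frontier, and neither has positive
  finite measure.\<close>

lemma admD:
  assumes "\<Omega> \<in> adm"
  shows "open \<Omega>" "convex \<Omega>" "frontier \<Omega> \<noteq> {}"
  using assms by (auto simp: adm_def frontier_eq_empty)

lemma adm_imp_measurable:
  assumes "\<Omega> \<in> adm"
  shows "\<Omega> \<in> sets borel" "\<Omega> \<in> lmeasurable" "emeasure lebesgue \<Omega> = ennreal (vol \<Omega>)" "0 < vol \<Omega>"
proof -
  show b: "\<Omega> \<in> sets borel" using assms by (auto simp: adm_def)
  show l: "\<Omega> \<in> lmeasurable" using b assms by (auto simp: adm_def fmeasurable_def)
  show e: "emeasure lebesgue \<Omega> = ennreal (vol \<Omega>)"
    using l by (simp add: vol_def emeasure_eq_measure2)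
  show "0 < vol \<Omega>" using assms e by (auto simp: adm_def)
qed

lemma omega_pos: "0 < omega TYPE('a::euclidean_space)"
  by (simp add: omega_def vol_def content_ball_pos)

lemma vol_ball: "0 \<le> r \<Longrightarrow> vol (ball (x :: 'a::euclidean_space) r) = omega TYPE('a) * r ^ DIM('a)"
  using content_ball_conv_unit_ball[of r x] by (simp add: omega_def vol_def)

lemma omega_bdist_le_vol:
  fixes \<Omega> :: "'a::euclidean_space set"
  assumes "\<Omega> \<in> adm" "x \<in> \<Omega>"
  shows "omega TYPE('a) * bdist \<Omega> x ^ DIM('a) \<le> vol \<Omega>"
proof -
  have "vol (ball x (bdist \<Omega> x)) \<le> vol \<Omega>"
    using ball_bdist_subset[OF assms(2)] adm_imp_measurable[OF assms(1)]
    unfolding vol_def by (intro measure_mono_fmeasurable) auto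
  then show ?thesis by (simp add: vol_ball)
qed

text \<open>A bound uniform in \<open>x\<close>, which makes the essential supremum finite.\<close>

lemma bdist_le_vol:
  fixes \<Omega> :: "'a::euclidean_space set"
  assumes "\<Omega> \<in> adm" "x \<in> \<Omega>"
  shows "bdist \<Omega> x \<le> root DIM('a) (vol \<Omega> / omega TYPE('a))"
proof -
  have "bdist \<Omega> x ^ DIM('a) \<le> vol \<Omega> / omega TYPE('a)"
    using omega_bdist_le_vol[OF assms] omega_pos[where 'a = 'a] by (simp add: field_simps)
  then have "root DIM('a) (bdist \<Omega> x ^ DIM('a)) \<le> root DIM('a) (vol \<Omega> / omega TYPE('a))"
    by simp
  then show ?thesis by (simp add: real_root_power_cancel)
qed

lemma Linf_norm_bdist_le:
  assumes "\<Omega> \<in> adm" "\<And>x. x \<in> \<Omega> \<Longrightarrow> bdist \<Omega> x \<le> c"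
  shows "Linf_norm (lebesgue_on \<Omega>) (bdist \<Omega>) \<le> ereal c"
  unfolding Linf_norm_def
proof (rule esssup_I)
  have "bdist \<Omega> \<in> borel_measurable lebesgue" by (simp add: measurable_completion)
  then have [measurable]: "bdist \<Omega> \<in> borel_measurable (lebesgue_on \<Omega>)"
    by (rule measurable_restrict_space1)
  show "(\<lambda>x. ereal \<bar>bdist \<Omega> x\<bar>) \<in> borel_measurable (lebesgue_on \<Omega>)" by measurable
  show "AE x in lebesgue_on \<Omega>. ereal \<bar>bdist \<Omega> x\<bar> \<le> ereal c"
    using assms by (intro AE_I2) (auto simp: space_restrict_space)
qed

text \<open>This holds at every point, not just almost everywhere: by continuity a strict excess at
  \<open>x\<close> would persist on a nonempty open set, which is not null.\<close>

lemma bdist_le_Linf_norm: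
  assumes "\<Omega> \<in> adm" "x \<in> \<Omega>"
  shows "ereal (bdist \<Omega> x) \<le> Linf_norm (lebesgue_on \<Omega>) (bdist \<Omega>)"
proof (rule ccontr)
  let ?L = "Linf_norm (lebesgue_on \<Omega>) (bdist \<Omega>)"
  assume *: "\<not> ereal (bdist \<Omega> x) \<le> ?L"
  define S where "S = \<Omega> \<inter> {y. ?L < ereal (bdist \<Omega> y)}"
  have "open {y. ?L < ereal (bdist \<Omega> y)}"
    by (intro open_Collect_less continuous_intros continuous_on_bdist)
  then have S: "open S" using assms by (auto simp: S_def adm_def)
  have "AE y in lebesgue_on \<Omega>. ereal \<bar>bdist \<Omega> y\<bar> \<le> ?L"
    unfolding Linf_norm_def by (rule esssup_AE)
  then have "AE y in lebesgue. y \<in> \<Omega> \<longrightarrow> ereal (bdist \<Omega> y) \<le> ?L"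
    using adm_imp_measurable[OF assms(1)] by (subst (asm) AE_restrict_space_iff) auto
  then have "AE y in lebesgue. y \<notin> S"
    by eventually_elim (auto simp: S_def)
  then have "S \<in> null_sets lebesgue"
    using S AE_iff_null_sets[of S lebesgue] by auto
  moreover have "x \<in> S" using assms * by (auto simp: S_def)
  ultimately show False
    using S open_not_negligible[of S] by (auto simp: negligible_iff_null_sets)
qed

lemma Linf_norm_bdist_eq:
  assumes "\<Omega> \<in> adm"
  shows "Linf_norm (lebesgue_on \<Omega>) (bdist \<Omega>) = ereal (inradius \<Omega>)"
proof -
  have "\<Omega> \<noteq> {}" using assms by (auto simp: adm_def)
  then obtain x where "x \<in> \<Omega>" by auto
  with bdist_le_Linf_norm[OF assms this] Linf_norm_bdist_le[OF assms bdist_le_vol[OF assms]]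
  have "Linf_norm (lebesgue_on \<Omega>) (bdist \<Omega>) \<noteq> \<infinity>" "Linf_norm (lebesgue_on \<Omega>) (bdist \<Omega>) \<noteq> - \<infinity>"
    by auto
  then show ?thesis by (auto simp: inradius_def ereal_real)
qed

text \<open>Together with \<open>inradius_le\<close> this identifies \<open>inradius\<close> as the
  ordinary supremum of \<open>bdist \<Omega>\<close> over \<open>\<Omega>\<close>.\<close>

lemma bdist_le_inradius: "\<Omega> \<in> adm \<Longrightarrow> x \<in> \<Omega> \<Longrightarrow> bdist \<Omega> x \<le> inradius \<Omega>"
  using bdist_le_Linf_norm[of \<Omega> x] by (simp add: Linf_norm_bdist_eq)

lemma inradius_le: "\<Omega> \<in> adm \<Longrightarrow> (\<And>x. x \<in> \<Omega> \<Longrightarrow> bdist \<Omega> x \<le> c) \<Longrightarrow> inradius \<Omega> \<le> c"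
  using Linf_norm_bdist_le[of \<Omega> c] by (simp add: Linf_norm_bdist_eq)

lemma inradius_pos:
  assumes "\<Omega> \<in> adm"
  shows "0 < inradius \<Omega>"
proof -
  have "\<Omega> \<noteq> {}" using assms by (auto simp: adm_def)
  then obtain x where x: "x \<in> \<Omega>" by auto
  from bdist_pos[OF admD(1,3)[OF assms] x] bdist_le_inradius[OF assms x]
  show ?thesis by simp
qed

section \<open>From nonnegative integrals to real integrals\<close>

text \<open>Both sides take the default value 0 when the integral is infinite.\<close>

lemma set_integral_bdist_eq:
  assumes "\<Omega> \<in> sets borel"
  shows "(LINT x:\<Omega>|lebesgue. bdist \<Omega> x) = enn2real (\<integral>\<^sup>+x. ennreal (bdist \<Omega> x) * indicator \<Omega> x \<partial>lborel)"
proof -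
  have [measurable]: "\<Omega> \<in> sets borel" by fact
  have "(LINT x:\<Omega>|lebesgue. bdist \<Omega> x) = (\<integral>x. indicator \<Omega> x *\<^sub>R bdist \<Omega> x \<partial>lborel)"
    unfolding set_lebesgue_integral_def by (rule integral_completion) measurable
  also have "\<dots> = enn2real (\<integral>\<^sup>+x. ennreal (indicator \<Omega> x *\<^sub>R bdist \<Omega> x) \<partial>lborel)"
    by (rule integral_eq_nn_integral) auto
  also have "(\<integral>\<^sup>+x. ennreal (indicator \<Omega> x *\<^sub>R bdist \<Omega> x) \<partial>lborel) = (\<integral>\<^sup>+x. ennreal (bdist \<Omega> x) * indicator \<Omega> x \<partial>lborel)"
    by (intro nn_integral_cong) (auto simp: indicator_def)
  finally show ?thesis .
qed

lemma nn_integral_bdist_eq: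
  assumes "\<Omega> \<in> adm"
  shows "(\<integral>\<^sup>+x. ennreal (bdist \<Omega> x) * indicator \<Omega> x \<partial>lborel) = ennreal (LINT x:\<Omega>|lebesgue. bdist \<Omega> x)"
proof -
  let ?I = "\<integral>\<^sup>+x. ennreal (bdist \<Omega> x) * indicator \<Omega> x \<partial>lborel"
  \<comment> \<open>The summand 1 supplies the strict bound that \<open>nn_integral_bdist_le\<close>
    asks for; any finite one would do.\<close>
  have "2 * ?I \<le> ennreal (inradius \<Omega> + 1) * ennreal (vol \<Omega>)"
    unfolding adm_imp_measurable(3)[OF assms, symmetric]
    using bdist_le_inradius[OF assms] by (intro nn_integral_bdist_le admD[OF assms] le_less_trans[OF _ less_add_one])
  then have "2 * ?I < \<infinity>"
    by (rule le_less_trans) (simp add: ennreal_mult_less_top)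
  then have "?I < \<infinity>"
    by (auto simp: ennreal_mult_less_top less_top)
  then show ?thesis
    using set_integral_bdist_eq[OF adm_imp_measurable(1)[OF assms]] by simp
qed

lemma set_integral_bdist_le:
  assumes "\<Omega> \<in> adm"
  shows "(LINT x:\<Omega>|lebesgue. bdist \<Omega> x) \<le> inradius \<Omega> * vol \<Omega> / 2"
proof -
  let ?I = "LINT x:\<Omega>|lebesgue. bdist \<Omega> x"
  have V: "0 < vol \<Omega>" using adm_imp_measurable[OF assms] by simp
  have "2 * ?I / vol \<Omega> \<le> inradius \<Omega>"
  \<comment> \<open>The strict bound is available for every \<open>\<rho>\<close> above the
    inradius; letting \<open>\<rho>\<close> decrease to it loses nothing.\<close>
  proof (rule dense_ge)
    fix \<rho> assume \<rho>: "inradius \<Omega> < \<rho>"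
    then have pos: "0 < \<rho>" using inradius_pos[OF assms] by simp
    have "2 * ennreal ?I \<le> ennreal \<rho> * ennreal (vol \<Omega>)"
      unfolding adm_imp_measurable(3)[OF assms, symmetric] nn_integral_bdist_eq[OF assms, symmetric]
      using bdist_le_inradius[OF assms] by (intro nn_integral_bdist_le admD[OF assms] le_less_trans[OF _ \<rho>])
    then have "ennreal (2 * ?I) \<le> ennreal (\<rho> * vol \<Omega>)"
      using V pos by (simp add: ennreal_mult')
    then have "2 * ?I \<le> \<rho> * vol \<Omega>"
      using V pos by (subst (asm) ennreal_le_iff) auto
    then show "2 * ?I / vol \<Omega> \<le> \<rho>" using V by (simp add: field_simps)
  qed
  then show ?thesis using V by (simp add: field_simps)
qed

lemma set_integral_bdist_ge:
  fixes \<Omega> :: "'a::euclidean_space set"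
  assumes "\<Omega> \<in> adm"
  shows "inradius \<Omega> * vol \<Omega> / (real DIM('a) + 1) \<le> (LINT x:\<Omega>|lebesgue. bdist \<Omega> x)"
proof -
  let ?I = "LINT x:\<Omega>|lebesgue. bdist \<Omega> x"
  have V: "0 < vol \<Omega>" using adm_imp_measurable[OF assms] by simp
  have I: "0 \<le> ?I"
    using set_integral_bdist_eq[OF adm_imp_measurable(1)[OF assms]] by simp
  \<comment> \<open>Solved for the inradius, the estimate can be checked at each centre
    \<open>x\<close>, so no maximiser of \<open>bdist\<close> has to be found.\<close>
  have "inradius \<Omega> \<le> ?I * (real DIM('a) + 1) / vol \<Omega>"
  proof (rule inradius_le[OF assms])
    fix x assume x: "x \<in> \<Omega>"
    have "ennreal (bdist \<Omega> x / (real DIM('a) + 1)) * ennreal (vol \<Omega>) \<le> ennreal ?I"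
      unfolding adm_imp_measurable(3)[OF assms, symmetric] nn_integral_bdist_eq[OF assms, symmetric]
      by (intro nn_integral_bdist_ge admD[OF assms] x)
    then have "ennreal (bdist \<Omega> x / (real DIM('a) + 1) * vol \<Omega>) \<le> ennreal ?I"
      using V by (subst ennreal_mult'') simp_all
    then have "bdist \<Omega> x / (real DIM('a) + 1) * vol \<Omega> \<le> ?I"
      using I by simp
    then show "bdist \<Omega> x \<le> ?I * (real DIM('a) + 1) / vol \<Omega>"
      using V by (simp add: field_simps)
  qed
  then show ?thesis using V by (simp add: field_simps)
qed

section \<open>Balls\<close>

lemma ball_adm:
  assumes "0 < r"
  shows "ball x r \<in> (adm :: 'a::euclidean_space set set)"
  using assms by (simp add: adm_def emeasure_ball)

text \<open>The inscribed ball about \<open>x\<close> gives one inequality, the end of the radius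
  through \<open>x\<close> the other.\<close>

lemma bdist_ball:
  assumes "x \<in> ball x0 r"
  shows "bdist (ball x0 r) (x :: 'a::euclidean_space) = r - dist x0 x"
proof (rule antisym)
  have r: "0 < r" using assms zero_le_dist[of x0 x] by (simp del: zero_le_dist)
  have "ball x (r - dist x0 x) \<subseteq> ball x0 r"
    by (simp add: ball_subset_ball_iff dist_commute)
  then show "r - dist x0 x \<le> bdist (ball x0 r) x"
    using admD(3)[OF ball_adm[OF r]] by (intro bdist_geI) auto
  \<comment> \<open>At the centre every direction is radial, so a basis vector serves.\<close>
  obtain u :: 'a where u: "norm u = 1" "x - x0 = dist x0 x *\<^sub>R u"
  proof (cases "x = x0")
    case True
    obtain u :: 'a where "u \<in> Basis" using SOME_Basis by blast
    then show ?thesis by (intro that[of u]) (simp_all add: True)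
  next
    case False
    show ?thesis
      using False by (intro that[of "(1 / norm (x - x0)) *\<^sub>R (x - x0)"]) (simp_all add: dist_norm norm_minus_commute[of x0 x])
  qed
  have "x0 + r *\<^sub>R u \<in> frontier (ball x0 r)"
    using r u by (simp add: dist_norm)
  then have "bdist (ball x0 r) x \<le> dist x (x0 + r *\<^sub>R u)"
    unfolding bdist_def by (rule infdist_le)
  also have "x - (x0 + r *\<^sub>R u) = - ((r - dist x0 x) *\<^sub>R u)"
    using u(2) by (simp add: algebra_simps)
  then have "dist x (x0 + r *\<^sub>R u) = r - dist x0 x"
    using u(1) assms by (simp add: dist_norm)
  finally show "bdist (ball x0 r) x \<le> r - dist x0 x" .
qed

lemma inradius_ball:
  assumes "0 < r"
  shows "inradius (ball (x0 :: 'a::euclidean_space) r) = r"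
proof (rule antisym)
  show "inradius (ball x0 r) \<le> r"
    using ball_adm[OF assms] by (rule inradius_le) (simp add: bdist_ball)
  show "r \<le> inradius (ball x0 r)"
    using bdist_le_inradius[OF ball_adm[OF assms], of x0 x0] assms by (simp add: bdist_ball)
qed

text \<open>The superlevel set at height \<open>t\<close> is the concentric ball of radius
  \<open>r - t\<close>, so the homothety estimate of \<open>emeasure_bdist_gt_ge\<close> becomes an
  equality.\<close>

lemma set_integral_bdist_ball:
  assumes "0 < r"
  shows "(LINT x:ball (x0 :: 'a::euclidean_space) r|lebesgue. bdist (ball x0 r) x) = r * vol (ball x0 r) / (real DIM('a) + 1)"
proof -
  let ?B = "ball x0 r"
  have V: "0 < vol ?B" using adm_imp_measurable(4)[OF ball_adm[OF assms]] .
  have "(\<integral>\<^sup>+x. ennreal (bdist ?B x) * indicator ?B x \<partial>lborel) =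
      (\<integral>\<^sup>+t. emeasure lebesgue {x \<in> ?B. t < bdist ?B x} * indicator {0<..} t \<partial>lborel)"
    by (rule nn_integral_bdist_layer_cake) simp
  also have "\<dots> = (\<integral>\<^sup>+t. ennreal ((1 - t / r) ^ DIM('a)) * indicator {0<..r} t * ennreal (vol ?B) \<partial>lborel)"
  proof (intro nn_integral_cong)
    fix t :: real
    have "emeasure lebesgue {x \<in> ?B. t < bdist ?B x} = ennreal ((1 - t / r) ^ DIM('a)) * ennreal (vol ?B)" if t: "0 < t" "t \<le> r"
    proof -
      have "{x \<in> ?B. t < bdist ?B x} = ball x0 (r - t)"
        using t by (auto simp: bdist_ball)
      then have "emeasure lebesgue {x \<in> ?B. t < bdist ?B x} = ennreal (vol (ball x0 (r - t)))"
        by (simp add: vol_def emeasure_eq_measure2 del: emeasure_completion)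
      also have "vol (ball x0 (r - t)) = (1 - t / r) ^ DIM('a) * vol ?B"
        using t assms by (simp add: vol_ball field_simps flip: power_mult_distrib)
      finally show ?thesis using V by (simp add: ennreal_mult'')
    qed
    moreover have "{x \<in> ?B. t < bdist ?B x} = {}" if "r < t"
      using that by (auto simp: bdist_ball) (smt (verit) zero_le_dist)
    ultimately show "emeasure lebesgue {x \<in> ?B. t < bdist ?B x} * indicator {0<..} t =
        ennreal ((1 - t / r) ^ DIM('a)) * indicator {0<..r} t * ennreal (vol ?B)"
      by (cases "0 < t"; cases "t \<le> r") (simp_all del: emeasure_completion mem_ball Collect_empty_eq)
  qed
  also have "\<dots> = ennreal (r / (real DIM('a) + 1)) * ennreal (vol ?B)"
    by (simp add: nn_integral_multc nn_integral_power_ramp[OF assms])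
  also have "\<dots> = ennreal (r * vol ?B / (real DIM('a) + 1))"
    using V by (subst ennreal_mult''[symmetric]) simp_all
  finally show ?thesis
    using V assms by (simp add: set_integral_bdist_eq)
qed

section \<open>Factorisation of the functional\<close>

text \<open>The scale-invariant quantity \<open>E\<close> of the overview.\<close>

definition elongation :: "'a::euclidean_space set \<Rightarrow> real" where
  "elongation \<Omega> = vol \<Omega> powr (1 / real DIM('a)) / inradius \<Omega>"

lemma F_inf_eq:
  fixes \<Omega> :: "'a::euclidean_space set"
  assumes "\<Omega> \<in> adm"
  shows "F_inf q \<Omega> =
    ((LINT x:\<Omega>|lebesgue. bdist \<Omega> x) / (inradius \<Omega> * vol \<Omega>)) powr q * elongation \<Omega> powr (1 - q)"
proof -
  let ?I = "LINT x:\<Omega>|lebesgue. bdist \<Omega> x"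
  let ?V = "vol \<Omega>" and ?\<rho> = "inradius \<Omega>"
  have V: "0 < ?V" and \<rho>: "0 < ?\<rho>"
    using adm_imp_measurable(4)[OF assms] inradius_pos[OF assms] by auto
  have I: "0 \<le> ?I / ?V"
    using set_integral_bdist_eq[OF adm_imp_measurable(1)[OF assms]] V by simp
  have "(?I / (?\<rho> * ?V)) powr q = ((?I / ?V) / ?\<rho>) powr q"
    by (simp add: field_simps)
  also have "\<dots> = (?I / ?V) powr q / ?\<rho> powr q"
    by (rule powr_divide)
  finally have 1: "(?I / (?\<rho> * ?V)) powr q = (?I / ?V) powr q / ?\<rho> powr q" .
  have "elongation \<Omega> powr (1 - q) = ?V powr ((1 - q) / real DIM('a)) / ?\<rho> powr (1 - q)"
    unfolding elongation_def using V \<rho> by (subst powr_divide) (auto simp: powr_powr)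
  also have "(1 - q) / real DIM('a) = - ((q - 1) / real DIM('a))"
    by (simp add: field_simps)
  also have "?V powr (- ((q - 1) / real DIM('a))) = 1 / ?V powr ((q - 1) / real DIM('a))"
    by (simp only: powr_minus_divide)
  finally have 2: "elongation \<Omega> powr (1 - q) = 1 / ?V powr ((q - 1) / real DIM('a)) / ?\<rho> powr (1 - q)" .
  \<comment> \<open>The first factor normalises the mean, the second goes with the volume into
    \<open>elongation\<close>.\<close>
  have "?\<rho> powr q * ?\<rho> powr (1 - q) = ?\<rho>"
    using \<rho> by (simp flip: powr_add)
  then show ?thesis
    unfolding 1 2 F_inf_def by (simp add: field_simps)
qed

text \<open>Volume comparison with inscribed balls, again solved for the inradius so that it can be
  checked pointwise.\<close>

lemma omega_le_elongation:
  fixes \<Omega> :: "'a::euclidean_space set"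
  assumes "\<Omega> \<in> adm"
  shows "omega TYPE('a) powr (1 / real DIM('a)) \<le> elongation \<Omega>"
proof -
  let ?d = "real DIM('a)"
  let ?w = "omega TYPE('a) powr (1 / ?d)" and ?v = "vol \<Omega> powr (1 / ?d)"
  have \<rho>: "0 < inradius \<Omega>" using inradius_pos[OF assms] .
  have w: "0 < ?w" using omega_pos[where 'a = 'a] by simp
  have "inradius \<Omega> \<le> ?v / ?w"
  proof (rule inradius_le[OF assms])
    fix x assume x: "x \<in> \<Omega>"
    have pos: "0 < bdist \<Omega> x" using bdist_pos[OF admD(1,3)[OF assms] x] .
    have "(omega TYPE('a) * bdist \<Omega> x ^ DIM('a)) powr (1 / ?d) \<le> ?v"
      using omega_bdist_le_vol[OF assms x] omega_pos[where 'a = 'a] by (intro powr_mono2) auto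
    also have "(omega TYPE('a) * bdist \<Omega> x ^ DIM('a)) powr (1 / ?d) = ?w * bdist \<Omega> x"
      using pos omega_pos[where 'a = 'a] by (simp add: powr_mult powr_powr flip: powr_realpow)
    finally show "bdist \<Omega> x \<le> ?v / ?w" using w by (simp add: field_simps)
  qed
  then show ?thesis using w \<rho> by (simp add: elongation_def field_simps)
qed

lemma elongation_ball:
  assumes "0 < r"
  shows "elongation (ball (x0 :: 'a::euclidean_space) r) = omega TYPE('a) powr (1 / real DIM('a))"
proof -
  have "(omega TYPE('a) * r ^ DIM('a)) powr (1 / real DIM('a)) = omega TYPE('a) powr (1 / real DIM('a)) * r"
    using assms omega_pos[where 'a = 'a] by (simp add: powr_mult powr_powr flip: powr_realpow)
  then show ?thesis using assms by (simp add: elongation_def vol_ball inradius_ball)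
qed

text \<open>With \<open>F_inf_le\<close> this leaves only the elongation to control; the sign of
  \<open>1 - q\<close> decides which way a bound on it acts.\<close>

lemma F_inf_ge:
  fixes \<Omega> :: "'a::euclidean_space set"
  assumes "\<Omega> \<in> adm" "0 < q"
  shows "(real DIM('a) + 1) powr (- q) * elongation \<Omega> powr (1 - q) \<le> F_inf q \<Omega>"
proof -
  have "1 / (real DIM('a) + 1) \<le> (LINT x:\<Omega>|lebesgue. bdist \<Omega> x) / (inradius \<Omega> * vol \<Omega>)"
    using set_integral_bdist_ge[OF assms(1)] inradius_pos[OF assms(1)] adm_imp_measurable(4)[OF assms(1)]
    by (simp add: field_simps)
  then have "(1 / (real DIM('a) + 1)) powr q \<le> ((LINT x:\<Omega>|lebesgue. bdist \<Omega> x) / (inradius \<Omega> * vol \<Omega>)) powr q"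
    using assms(2) by (intro powr_mono2) auto
  then show ?thesis
    unfolding F_inf_eq[OF assms(1)] by (intro mult_right_mono) (auto simp: powr_minus_divide powr_divide)
qed

lemma F_inf_le:
  fixes \<Omega> :: "'a::euclidean_space set"
  assumes "\<Omega> \<in> adm" "0 < q"
  shows "F_inf q \<Omega> \<le> (1 / 2) powr q * elongation \<Omega> powr (1 - q)"
proof -
  have "0 \<le> (LINT x:\<Omega>|lebesgue. bdist \<Omega> x) / (inradius \<Omega> * vol \<Omega>)"
    using set_integral_bdist_eq[OF adm_imp_measurable(1)[OF assms(1)]] inradius_pos[OF assms(1)]
      adm_imp_measurable(4)[OF assms(1)] by simp
  moreover have "(LINT x:\<Omega>|lebesgue. bdist \<Omega> x) / (inradius \<Omega> * vol \<Omega>) \<le> 1 / 2"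
    using set_integral_bdist_le[OF assms(1)] inradius_pos[OF assms(1)] adm_imp_measurable(4)[OF assms(1)]
    by (simp add: field_simps)
  ultimately have "((LINT x:\<Omega>|lebesgue. bdist \<Omega> x) / (inradius \<Omega> * vol \<Omega>)) powr q \<le> (1 / 2) powr q"
    using assms(2) by (intro powr_mono2) auto
  then show ?thesis
    unfolding F_inf_eq[OF assms(1)] by (intro mult_right_mono) auto
qed

lemma F_inf_ball:
  assumes "0 < r"
  shows "F_inf q (ball (x0 :: 'a::euclidean_space) r) =
    (real DIM('a) + 1) powr (- q) * omega TYPE('a) powr ((1 - q) / real DIM('a))"
proof -
  have "(LINT x:ball x0 r|lebesgue. bdist (ball x0 r) x) / (inradius (ball x0 r) * vol (ball x0 r)) = 1 / (real DIM('a) + 1)"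
    using assms adm_imp_measurable(4)[OF ball_adm[OF assms, of x0]]
    by (simp add: set_integral_bdist_ball inradius_ball)
  then show ?thesis
    unfolding F_inf_eq[OF ball_adm[OF assms]]
    by (simp add: elongation_ball[OF assms] powr_powr powr_minus_divide powr_divide)
qed

section \<open>Thin boxes and the degenerate limits\<close>

text \<open>A box of width \<open>e\<close> in one direction and 1 in the others has volume
  \<open>e\<close> and inradius at most \<open>e\<close>, so its elongation is at least
  \<open>e powr (1 / d - 1)\<close>, which blows up as \<open>e\<close> tends to 0 when
  \<open>d\<close> is at least 2. On the line the admissible sets are intervals, all of elongation
  2.\<close>

lemma ex_elongation_ge:
  assumes "2 \<le> DIM('a::euclidean_space)"
  shows "\<exists>\<Omega> \<in> (adm :: 'a set set). K \<le> elongation \<Omega>"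
proof -
  let ?d = "real DIM('a)"
  define L where "L = max 1 K"
  \<comment> \<open>The solution of \<open>e powr (1 / ?d - 1) = L\<close>; \<open>L \<ge> 1\<close>
    keeps the base positive.\<close>
  define e where "e = L powr (- ?d / (?d - 1))"
  have L: "1 \<le> L" "K \<le> L" by (auto simp: L_def)
  have e: "0 < e" using L by (simp add: e_def)
  obtain b :: 'a where b: "b \<in> Basis" using SOME_Basis by blast
  define s where "s = (\<lambda>i. if i = b then e else 1)"
  define \<Omega> where "\<Omega> = box 0 (\<Sum>i\<in>Basis. s i *\<^sub>R i)"
  have V: "emeasure lborel \<Omega> = ennreal e"
  proof -
    have "emeasure lborel \<Omega> = ennreal (\<Prod>i\<in>Basis. s i)"
      unfolding \<Omega>_def using e by (subst emeasure_lborel_box) (auto simp: s_def)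
    then show ?thesis using b by (simp add: s_def prod.delta)
  qed
  have adm: "\<Omega> \<in> adm"
    using V e by (auto simp: adm_def \<Omega>_def convex_box)
  have vol: "vol \<Omega> = e" using adm_imp_measurable(3,4)[OF adm] V e by (simp add: \<Omega>_def)
  have "inradius \<Omega> \<le> e"
  proof (rule inradius_le[OF adm])
    fix x assume x: "x \<in> \<Omega>"
    show "bdist \<Omega> x \<le> e"
    \<comment> \<open>A shift by \<open>t\<close> along \<open>b\<close> stays in the box, whose
      width in that direction is \<open>e\<close>.\<close>
    proof (rule dense_le_bounded)
      show "0 < bdist \<Omega> x" using bdist_pos[OF admD(1,3)[OF adm] x] .
      fix t assume t: "0 < t" "t < bdist \<Omega> x"
      then have "x + t *\<^sub>R b \<in> \<Omega>"
        using ball_bdist_subset[OF x] b by (auto simp: dist_norm subset_iff)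
      then have "(x + t *\<^sub>R b) \<bullet> b < e" "0 < x \<bullet> b"
        using x b by (auto simp: \<Omega>_def mem_box s_def)
      then show "t \<le> e" using b by (simp add: inner_add_left)
    qed
  qed
  then have "e powr (1 / ?d) / e \<le> elongation \<Omega>"
    using inradius_pos[OF adm] unfolding elongation_def vol by (intro divide_left_mono) auto
  moreover have "e powr (1 / ?d) / e = L"
  proof -
    have "e powr (1 / ?d) / e = e powr (1 / ?d - 1)"
      using e by (simp add: powr_diff)
    also have "\<dots> = L powr (- ?d / (?d - 1) * (1 / ?d - 1))"
      by (simp only: e_def powr_powr)
    also have "- ?d / (?d - 1) * (1 / ?d - 1) = 1"
      using assms by (simp add: field_simps)
    finally show ?thesis using L by simp
  qed
  ultimately show ?thesis using adm L by force
qed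

lemma SUP_F_inf_eq_PInfty:
  assumes "0 < q" "q < 1" "2 \<le> DIM('a::euclidean_space)"
  shows "(SUP \<Omega>\<in>(adm :: 'a set set). ereal (F_inf q \<Omega>)) = \<infinity>"
proof (rule SUP_PInfty)
  fix n :: nat
  \<comment> \<open>\<open>?K\<close> is the elongation at which the lower bound of
    \<open>F_inf_ge\<close> equals \<open>n\<close>.\<close>
  let ?D = "(real DIM('a) + 1) powr q" and ?K = "((real DIM('a) + 1) powr q * real n) powr (1 / (1 - q))"
  obtain \<Omega> :: "'a set" where \<Omega>: "\<Omega> \<in> adm" "?K \<le> elongation \<Omega>"
    using ex_elongation_ge[OF assms(3)] by blast
  have "real n = ?D powr (- 1) * ?K powr (1 - q)"
    using assms by (simp add: powr_powr powr_minus)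
  also have "\<dots> \<le> (real DIM('a) + 1) powr (- q) * elongation \<Omega> powr (1 - q)"
    using \<Omega> assms by (intro mult_mono powr_mono2) (auto simp: powr_minus_divide)
  also have "\<dots> \<le> F_inf q \<Omega>"
    using F_inf_ge \<Omega> assms by blast
  finally show "\<exists>\<Omega>\<in>(adm :: 'a set set). ereal (real n) \<le> ereal (F_inf q \<Omega>)"
    using \<Omega> by auto
qed

lemma INF_F_inf_eq_0:
  assumes "1 < q" "2 \<le> DIM('a::euclidean_space)"
  shows "(INF \<Omega>\<in>(adm :: 'a set set). ereal (F_inf q \<Omega>)) = 0"
proof (rule antisym)
  show "0 \<le> (INF \<Omega>\<in>(adm :: 'a set set). ereal (F_inf q \<Omega>))"
    by (intro INF_greatest) (simp add: F_inf_eq)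
  show "(INF \<Omega>\<in>(adm :: 'a set set). ereal (F_inf q \<Omega>)) \<le> 0"
  proof (rule ereal_le_epsilon2)
    fix e :: real assume e: "0 < e"
    \<comment> \<open>As \<open>1 - q\<close> is negative, large elongation makes the bound of
      \<open>F_inf_le\<close> small; at this threshold the elongation factor is exactly
      \<open>e\<close>.\<close>
    obtain \<Omega> :: "'a set" where \<Omega>: "\<Omega> \<in> adm" "e powr (1 / (1 - q)) \<le> elongation \<Omega>"
      using ex_elongation_ge[OF assms(2)] by blast
    have "F_inf q \<Omega> \<le> (1 / 2) powr q * elongation \<Omega> powr (1 - q)"
      using F_inf_le[OF \<Omega>(1)] assms by simp
    also have "\<dots> \<le> 1 * (e powr (1 / (1 - q))) powr (1 - q)"
    proof (rule mult_mono)
      show "(1 / 2) powr q \<le> (1::real)"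
        using powr_mono2[of q "1 / 2" 1] assms by simp
      show "elongation \<Omega> powr (1 - q) \<le> (e powr (1 / (1 - q))) powr (1 - q)"
        using assms e \<Omega>(2) by (intro powr_mono2') auto
    qed simp_all
    also have "\<dots> = e" using assms e by (simp add: powr_powr)
    finally show "(INF \<Omega>\<in>(adm :: 'a set set). ereal (F_inf q \<Omega>)) \<le> 0 + ereal e"
      using \<Omega> by (intro INF_lower2[OF \<Omega>(1)]) simp
  qed
qed

section \<open>Extrema of \<open>F_inf\<close> over admissible sets\<close>

theorem corollary6p4:
  fixes q :: real and B :: "'a::euclidean_space set"
  assumes ball: "\<exists>x r. 0 < r \<and> B = ball x r"
  shows
    "(0 < q \<and> q < 1 \<longrightarrow>
        (DIM('a) \<ge> 2 \<longrightarrow> (SUP \<Omega>\<in>(adm :: 'a set set). ereal (F_inf q \<Omega>)) = \<infinity>) \<and>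
        is_arg_min (F_inf q) (\<lambda>\<Omega>. \<Omega> \<in> adm) B \<and>
        F_inf q B = (real DIM('a) + 1) powr (- q) * omega TYPE('a) powr ((1 - q) / real DIM('a))) \<and>
     (1 < q \<longrightarrow>
        (SUP \<Omega>\<in>(adm :: 'a set set). ereal (F_inf q \<Omega>)) \<le>
          ereal ((1 / 2) powr q * omega TYPE('a) powr ((1 - q) / real DIM('a))) \<and>
        (DIM('a) \<ge> 2 \<longrightarrow> (INF \<Omega>\<in>(adm :: 'a set set). ereal (F_inf q \<Omega>)) = 0))"
proof (intro conjI impI; (elim conjE)?)
  obtain x r where B: "0 < r" "B = ball x r" using ball by auto
  let ?w = "omega TYPE('a) powr (1 / real DIM('a))"
  have w: "0 < ?w" "?w powr (1 - q) = omega TYPE('a) powr ((1 - q) / real DIM('a))"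
    using omega_pos[where 'a = 'a] by (auto simp: powr_powr)
  show FB: "F_inf q B = (real DIM('a) + 1) powr (- q) * omega TYPE('a) powr ((1 - q) / real DIM('a))"
    using F_inf_ball B by simp
  show "is_arg_min (F_inf q) (\<lambda>\<Omega>. \<Omega> \<in> adm) B" if q: "0 < q" "q < 1"
  proof -
    \<comment> \<open>Here \<open>1 - q\<close> is positive, so the lower bound of
      \<open>F_inf_ge\<close> is least at the least elongation; balls have that elongation and
      attain the bound.\<close>
    have "F_inf q B \<le> F_inf q \<Omega>" if \<Omega>: "\<Omega> \<in> adm" for \<Omega> :: "'a set"
    proof -
      have "F_inf q B \<le> (real DIM('a) + 1) powr (- q) * elongation \<Omega> powr (1 - q)"
        unfolding FB w(2)[symmetric]
        using q w omega_le_elongation[OF \<Omega>] by (intro mult_left_mono powr_mono2) auto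
      also have "\<dots> \<le> F_inf q \<Omega>" using F_inf_ge[OF \<Omega> q(1)] .
      finally show ?thesis .
    qed
    then show ?thesis using ball_adm B by (force simp: is_arg_min_def)
  qed
  show "(SUP \<Omega>\<in>(adm :: 'a set set). ereal (F_inf q \<Omega>)) \<le>
      ereal ((1 / 2) powr q * omega TYPE('a) powr ((1 - q) / real DIM('a)))" if q: "1 < q"
  proof (rule SUP_least)
    fix \<Omega> :: "'a set" assume \<Omega>: "\<Omega> \<in> adm"
    have "F_inf q \<Omega> \<le> (1 / 2) powr q * elongation \<Omega> powr (1 - q)"
      using F_inf_le[OF \<Omega>] q by simp
    \<comment> \<open>The negative exponent turns the lower bound on the elongation into an upper
      bound.\<close>
    also have "\<dots> \<le> (1 / 2) powr q * ?w powr (1 - q)"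
      using q w(1) omega_le_elongation[OF \<Omega>] by (intro mult_left_mono powr_mono2') auto
    finally show "ereal (F_inf q \<Omega>) \<le> ereal ((1 / 2) powr q * omega TYPE('a) powr ((1 - q) / real DIM('a)))"
      unfolding w(2) by simp
  qed
qed (simp_all add: SUP_F_inf_eq_PInfty INF_F_inf_eq_0)

end
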